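(* Let $g\colon\mathbb{D}\to\mathbb{D}$ be a parabolic holomorphic map of finite shift whose Denjoy-Wolff point is $\tau\in\partial\mathbb{D}$. Then there exists a constant $C=C(g)>0$ such that $$n\,|g^n-\tau|\to C, \quad n\to+\infty,$$ uniformly on compact subsets of $\mathbb{D}$.
   Context: $\mathbb{D}$ is the open unit disk, $\mathbb{H}=\{z\in\mathbb{C}:\mathrm{Im}\,z>0\}$ is the upper half-plane, and $g^n$ denotes the $n$-th iterate of $g$ ($g^0=\mathrm{Id}$, $g^{n+1}=g\circ g^n$). A holomorphic $g\colon\mathbb{D}\to\mathbb{D}$ is non-elliptic if it has no fixed point in $\mathbb{D}$; then $g^n$ converges, uniformly on compact subsets of $\mathbb{D}$, to a point $\tau\in\partial\mathbb{D}$, called the Denjoy-Wolff point of $g$. Let $S\colon\mathbb{D}\to\mathbb{H}$, $S(z)=i\frac{\tau+z}{\tau-z}$, and $f=S\circ g\circ S^{-1}\colon\mathbb{H}\to\mathbb{H}$, which has no fixed points and whose Denjoy-Wolff point is $\infty$. The map $g$ is parabolic if $f$ is, i.e. if the angular (non-tangential) limit $\angle\lim_{w\to\infty}f(w)/w$ equals $1$. A parabolic $g$ is of finite shift if there exist some orbit $(g^n(z_0))_{n\ge 0}$, $z_0\in\mathbb{D}$, and a horocycle $\{z\in\mathbb{D}: |\tau-z|^2/(1-|z|^2)<R\}$, $R>0$, of center $\tau$ in which the orbit does not enter; equivalently, there is $w_0\in\mathbb{H}$ with $\sup_n \mathrm{Im}\, f^n(w_0)<+\infty$. *)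

theory Defs
  imports "HOL-Complex_Analysis.Complex_Analysis"
begin

abbreviation unit_disk :: "complex set" where
  "unit_disk \<equiv> ball 0 1"

definition upper_half_plane :: "complex set" where
  "upper_half_plane = {w. 0 < Im w}"

definition holomorphic_self_map_disk :: "(complex \<Rightarrow> complex) \<Rightarrow> bool" where
  "holomorphic_self_map_disk g \<longleftrightarrow> g holomorphic_on unit_disk \<and> g ` unit_disk \<subseteq> unit_disk"

definition non_elliptic :: "(complex \<Rightarrow> complex) \<Rightarrow> bool" where
  "non_elliptic g \<longleftrightarrow> holomorphic_self_map_disk g \<and> \<not> (\<exists>z\<in>unit_disk. g z = z)"

text \<open>The Denjoy-Wolff point is unique when it exists, so it is rendered as a relation.\<close>

definition denjoy_wolff_point :: "(complex \<Rightarrow> complex) \<Rightarrow> complex \<Rightarrow> bool" where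
  "denjoy_wolff_point g \<tau> \<longleftrightarrow> \<tau> \<in> sphere 0 1 \<and>
     (\<forall>K. compact K \<and> K \<subseteq> unit_disk \<longrightarrow>
        uniform_limit K (\<lambda>n z. (g ^^ n) z) (\<lambda>_. \<tau>) sequentially)"

definition cayley :: "complex \<Rightarrow> complex \<Rightarrow> complex" where
  "cayley \<tau> z = \<i> * ((\<tau> + z) / (\<tau> - z))"

text \<open>The map \<open>S \<circ> g \<circ> S\<inverse>\<close>; its values are meaningful only on the upper half-plane.\<close>

definition half_plane_conjugate :: "complex \<Rightarrow> (complex \<Rightarrow> complex) \<Rightarrow> complex \<Rightarrow> complex" where
  "half_plane_conjugate \<tau> g = cayley \<tau> \<circ> g \<circ> inv_into unit_disk (cayley \<tau>)"

text \<open>Non-tangential limit at infinity from within the upper half-plane: the limit along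
  every sector symmetric about the imaginary axis with opening angle less than \<open>\<pi>\<close>
  (namely \<open>2 * arctan k\<close>).\<close>

definition angular_limit_at_infinity :: "(complex \<Rightarrow> complex) \<Rightarrow> complex \<Rightarrow> bool" where
  "angular_limit_at_infinity h l \<longleftrightarrow>
     (\<forall>k>0. (h \<longlongrightarrow> l)
        (inf at_infinity (principal {w\<in>upper_half_plane. \<bar>Re w\<bar> \<le> k * Im w})))"

text \<open>In the next two definitions \<open>\<tau>\<close> is meant to be the Denjoy-Wolff point of \<open>g\<close>.\<close>

definition parabolic :: "(complex \<Rightarrow> complex) \<Rightarrow> complex \<Rightarrow> bool" where
  "parabolic g \<tau> \<longleftrightarrow> non_elliptic g \<and> denjoy_wolff_point g \<tau> \<and>
     angular_limit_at_infinity (\<lambda>w. half_plane_conjugate \<tau> g w / w) 1"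

definition horocycle :: "complex \<Rightarrow> real \<Rightarrow> complex set" where
  "horocycle \<tau> R = {z\<in>unit_disk. (cmod (\<tau> - z))\<^sup>2 / (1 - (cmod z)\<^sup>2) < R}"

definition finite_shift :: "(complex \<Rightarrow> complex) \<Rightarrow> complex \<Rightarrow> bool" where
  "finite_shift g \<tau> \<longleftrightarrow> parabolic g \<tau> \<and>
     (\<exists>z\<^sub>0\<in>unit_disk. \<exists>R>0. \<forall>n. (g ^^ n) z\<^sub>0 \<notin> horocycle \<tau> R)"

end

theory Submission
  imports Defs
begin

text \<open>
  Conjugation by the Cayley map turns \<open>g\<close> into a holomorphic self-map \<open>f\<close> of the upper half-plane
  without fixed points, and \<open>S z + \<i> = 2 \<i> \<tau> / (\<tau> - z)\<close> turns the claim into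
  \<open>f\<^sup>n / n \<rightarrow> b\<close> for a constant \<open>b \<noteq> 0\<close>, uniformly on compact sets; the limit \<open>C\<close> is then
  \<open>2 / \<bar>b\<bar>\<close>.  All estimates come from the Schwarz-Pick inequality, which here is stated for
  holomorphic functions with nonnegative imaginary part, together with its Harnack-type consequence
  \<open>\<bar>F w - F v\<bar> \<le> B * Im (F v)\<close>, where \<open>B\<close> depends only on \<open>v\<close> and on a compact set
  containing \<open>w\<close>.

  Since \<open>f w / w\<close> tends to \<open>1\<close> along the imaginary axis, letting one of the two points of the
  Schwarz-Pick inequality go to infinity gives \<open>Im (f w) \<ge> Im w\<close> (\<open>Julia_half_plane\<close>).
  So the heights along an orbit increase, and finite shift provides an orbit, that of \<open>v\<close> say, whose
  heights stay bounded and hence converge.  Put \<open>x\<^sub>n = Re (f\<^sup>n v)\<close>.  For \<open>m \<ge> n\<close> the difference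
  \<open>(f\<^sup>m - x\<^sub>m) - (f\<^sup>n - x\<^sub>n)\<close> has nonnegative imaginary part, and its value at \<open>v\<close> is small and purely
  imaginary; Harnack's inequality makes it small on every compact set.  Thus
  \<open>f\<^sup>n - x\<^sub>n\<close> converges locally uniformly to a holomorphic \<open>q\<close>, and comparing the limits at \<open>w\<close> and at \<open>f w\<close> gives
  \<open>x\<^bsub>n+1\<^esub> - x\<^sub>n \<rightarrow> b\<close> where \<open>b = q (f w) - q w\<close> for every \<open>w\<close>.

  The crux is \<open>b \<noteq> 0\<close>.  Otherwise \<open>q\<close> would take equal values at \<open>w\<close> and \<open>f w\<close> for all \<open>w\<close>.
  But \<open>Im (q w) \<ge> Im w\<close>, so \<open>c = inf Im q / Im\<close> is at least \<open>1\<close>, and \<open>r = q - c * id\<close>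
  still has nonnegative imaginary part.  Choose \<open>w\<close> with \<open>Im (q w) < 2 c * Im w\<close>.  If \<open>w'\<close> is at
  least as high as \<open>w\<close> and \<open>q w' = q w\<close>, then \<open>Im r < c * Im\<close> at both points, while
  \<open>\<bar>r w' - r w\<bar> = c \<bar>w' - w\<bar>\<close>; by Schwarz-Pick this is possible only if \<open>w' = w\<close>
  (\<open>injective_point_of_half_plane_map\<close>).  With \<open>w' = f w\<close> this yields a fixed point of \<open>f\<close>,
  a contradiction.

  Averaging the increments gives \<open>f\<^sup>n v / n \<rightarrow> b\<close>, and since Harnack's inequality bounds
  \<open>f\<^sup>n w - f\<^sup>n v\<close> uniformly in \<open>n\<close> and in \<open>w\<close> from a compact set, the same limit holds uniformly on
  compact sets.
\<close>

section \<open>Schwarz-Pick and Harnack estimates in the upper half-plane\<close>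

lemma cmod_diff_cnj_power2:
  "(cmod (w - cnj v))\<^sup>2 = (cmod (w - v))\<^sup>2 + 4 * Im w * Im v"
  by (simp add: cmod_power2) (simp add: power2_eq_square algebra_simps)

lemma cmod_diff_less_diff_cnj_iff:
  assumes "0 < Im v"
  shows "cmod (w - v) < cmod (w - cnj v) \<longleftrightarrow> 0 < Im w"
proof -
  have "cmod (w - v) < cmod (w - cnj v) \<longleftrightarrow> (cmod (w - v))\<^sup>2 < (cmod (w - cnj v))\<^sup>2"
    by (metis norm_ge_zero power2_less_imp_less power_strict_mono zero_less_numeral)
  also have "\<dots> \<longleftrightarrow> 0 < Im w"
    unfolding cmod_diff_cnj_power2 using assms by (simp add: zero_less_mult_iff)
  finally show ?thesis .
qed

lemma open_upper_half_plane: "open upper_half_plane"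
  unfolding upper_half_plane_def by (rule open_halfspace_Im_gt)

text \<open>
  The Schwarz lemma, applied to \<open>F\<close> read in the Cayley coordinates centred at \<open>v\<close> and at \<open>F v\<close>,
  bounds \<open>\<bar>F w - F v\<bar> / \<bar>F w - cnj (F v)\<bar>\<close> by \<open>\<bar>w - v\<bar> / \<bar>w - cnj v\<bar>\<close>.  The identity above
  removes the conjugate points.
\<close>
lemma Schwarz_Pick_half_plane_strict:
  assumes hol: "F holomorphic_on upper_half_plane"
    and pos: "\<And>u. u \<in> upper_half_plane \<Longrightarrow> 0 < Im (F u)"
    and w: "0 < Im w" and v: "0 < Im v"
  shows "(cmod (F w - F v))\<^sup>2 * (Im w * Im v) \<le> (cmod (w - v))\<^sup>2 * (Im (F w) * Im (F v))"
proof -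
  \<comment> \<open>the conformal map from the disk onto the half-plane that sends \<open>0\<close> to \<open>v\<close>\<close>
  define \<psi> where "\<psi> = (\<lambda>\<zeta>. (v - cnj v * \<zeta>) / (1 - \<zeta>))"
  define G where "G = (\<lambda>\<zeta>. (F (\<psi> \<zeta>) - F v) / (F (\<psi> \<zeta>) - cnj (F v)))"
  have ne1: "1 - \<zeta> \<noteq> 0" if "cmod \<zeta> < 1" for \<zeta> :: complex
    using that by auto
  have vv: "v - cnj v \<noteq> 0" using v by (simp add: complex_eq_iff)
  have \<psi>_H: "\<psi> \<zeta> \<in> upper_half_plane" if \<zeta>: "cmod \<zeta> < 1" for \<zeta>
  proof -
    have 1: "\<psi> \<zeta> - v = (v - cnj v) / (1 - \<zeta>) * \<zeta>" and 2: "\<psi> \<zeta> - cnj v = (v - cnj v) / (1 - \<zeta>)"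
      unfolding \<psi>_def using ne1[OF \<zeta>] by (simp_all add: field_simps)
    have "0 < cmod ((v - cnj v) / (1 - \<zeta>))"
      using vv ne1[OF \<zeta>] by simp
    then have "cmod (\<psi> \<zeta> - v) < cmod (\<psi> \<zeta> - cnj v)"
      unfolding 1 2 norm_mult[of _ \<zeta>] using \<zeta> by (metis mult.right_neutral mult_strict_left_mono)
    then show ?thesis
      using cmod_diff_less_diff_cnj_iff[OF v] by (simp add: upper_half_plane_def)
  qed
  have Fv: "0 < Im (F v)" using pos v by (simp add: upper_half_plane_def)
  have G_less: "cmod (G \<zeta>) < 1" if "cmod \<zeta> < 1" for \<zeta>
  proof -
    have "cmod (F (\<psi> \<zeta>) - F v) < cmod (F (\<psi> \<zeta>) - cnj (F v))"
      using cmod_diff_less_diff_cnj_iff[OF Fv] pos[OF \<psi>_H[OF that]] by simp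
    then show ?thesis
      unfolding G_def norm_divide
      by (metis divide_less_eq_1_pos norm_ge_zero order_le_less_trans)
  qed
  have "\<psi> holomorphic_on ball 0 1"
    unfolding \<psi>_def by (intro holomorphic_intros) (use ne1 in auto)
  then have "(F \<circ> \<psi>) holomorphic_on ball 0 1"
    by (rule holomorphic_on_compose_gen[OF _ hol]) (use \<psi>_H in auto)
  moreover have "F (\<psi> \<zeta>) - cnj (F v) \<noteq> 0" if "\<zeta> \<in> ball 0 1" for \<zeta>
  proof -
    have "Im (F (\<psi> \<zeta>) - cnj (F v)) > 0"
      using pos[OF \<psi>_H] Fv that by (simp add: add_pos_pos)
    then show ?thesis by auto
  qed
  ultimately have holG: "G holomorphic_on ball 0 1"
    unfolding G_def comp_def by (intro holomorphic_intros) auto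
  have G0: "G 0 = 0" by (simp add: G_def \<psi>_def)
  define \<zeta> where "\<zeta> = (w - v) / (w - cnj v)"
  have wv: "cmod (w - v) < cmod (w - cnj v)"
    using cmod_diff_less_diff_cnj_iff[OF v] w by simp
  then have pos_d: "0 < cmod (w - cnj v)"
    using norm_ge_zero order_le_less_trans by blast
  have \<zeta>1: "cmod \<zeta> < 1"
    unfolding \<zeta>_def norm_divide using wv pos_d by simp
  have wc: "w - cnj v \<noteq> 0" using pos_d by auto
  have a: "1 - \<zeta> = (v - cnj v) / (w - cnj v)"
    unfolding \<zeta>_def using wc by (simp add: field_simps)
  have b: "v - cnj v * \<zeta> = (v - cnj v) * w / (w - cnj v)"
    unfolding \<zeta>_def using wc by (simp add: field_simps)
  have \<psi>\<zeta>: "\<psi> \<zeta> = w"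
    unfolding \<psi>_def a b using vv wc by simp
  have FF: "0 < cmod (F w - cnj (F v))"
    using cmod_diff_less_diff_cnj_iff[OF Fv, of "F w"] pos[of w] w norm_ge_zero
    by (metis (no_types, lifting) mem_Collect_eq order_le_less_trans upper_half_plane_def)
  have "cmod (G \<zeta>) \<le> cmod \<zeta>"
    by (rule Schwarz_Lemma(1)[OF holG G0 G_less \<zeta>1])
  then have "cmod (F w - F v) / cmod (F w - cnj (F v)) \<le> cmod (w - v) / cmod (w - cnj v)"
    unfolding G_def \<psi>\<zeta> norm_divide by (simp add: \<zeta>_def norm_divide)
  then have "cmod (F w - F v) * cmod (w - cnj v) \<le> cmod (w - v) * cmod (F w - cnj (F v))"
    using FF pos_d by (simp add: field_simps)
  then have "(cmod (F w - F v) * cmod (w - cnj v))\<^sup>2 \<le> (cmod (w - v) * cmod (F w - cnj (F v)))\<^sup>2"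
    by (intro power_mono) auto
  then show ?thesis
    unfolding power_mult_distrib cmod_diff_cnj_power2 by (simp add: algebra_simps)
qed

text \<open>
  Differences of iterates may touch the real axis, so the inequality is needed for functions into the
  closed half-plane.  Adding \<open>\<i> * e\<close> to \<open>F\<close> and letting \<open>e\<close> tend to \<open>0\<close> reduces it to the strict case.
\<close>
lemma Schwarz_Pick_half_plane:
  assumes hol: "F holomorphic_on upper_half_plane"
    and nonneg: "\<And>u. u \<in> upper_half_plane \<Longrightarrow> 0 \<le> Im (F u)"
    and w: "0 < Im w" and v: "0 < Im v"
  shows "(cmod (F w - F v))\<^sup>2 * (Im w * Im v) \<le> (cmod (w - v))\<^sup>2 * (Im (F w) * Im (F v))"
proof (rule tendsto_lowerbound)
  let ?R = "\<lambda>e. (cmod (w - v))\<^sup>2 * ((Im (F w) + e) * (Im (F v) + e))"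
  have "(?R \<longlongrightarrow> ?R 0) (at_right 0)"
    by (intro tendsto_intros)
  then show "(?R \<longlongrightarrow> (cmod (w - v))\<^sup>2 * (Im (F w) * Im (F v))) (at_right 0)"
    by simp
  have "(cmod (F w - F v))\<^sup>2 * (Im w * Im v) \<le> ?R e" if "e > 0" for e
  proof -
    have "(\<lambda>u. F u + \<i> * of_real e) holomorphic_on upper_half_plane"
      by (intro holomorphic_intros hol)
    moreover have "0 < Im (F u + \<i> * of_real e)" if "u \<in> upper_half_plane" for u
      using nonneg[OF that] \<open>e > 0\<close> by simp
    ultimately show ?thesis
      using Schwarz_Pick_half_plane_strict[of "\<lambda>u. F u + \<i> * of_real e" w v] w v by simp
  qed
  then show "\<forall>\<^sub>F e in at_right 0. (cmod (F w - F v))\<^sup>2 * (Im w * Im v) \<le> ?R e"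
    by (auto simp: eventually_at_right_less intro: eventually_mono[OF eventually_at_right_less])
qed simp

text \<open>
  For \<open>e = \<bar>F w - F v\<bar>\<close> the inequality \<open>Im (F w) \<le> Im (F v) + e\<close> turns Schwarz-Pick into a
  quadratic inequality for \<open>e\<close>.  The resulting bound on the full complex difference, linear in
  \<open>Im (F v)\<close>, is what makes a small imaginary part at one point control \<open>F\<close> everywhere.
\<close>
lemma Harnack_half_plane:
  assumes hol: "F holomorphic_on upper_half_plane"
    and nonneg: "\<And>u. u \<in> upper_half_plane \<Longrightarrow> 0 \<le> Im (F u)"
    and w: "0 < Im w" and v: "0 < Im v"
  shows "cmod (F w - F v) \<le> ((cmod (w - v))\<^sup>2 / (Im w * Im v) + 1) * Im (F v)"
proof (rule ccontr)
  define k where "k = (cmod (w - v))\<^sup>2 / (Im w * Im v)"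
  define e where "e = cmod (F w - F v)"
  have k: "0 \<le> k" unfolding k_def using w v by simp
  have Fv: "0 \<le> Im (F v)" using nonneg v by (simp add: upper_half_plane_def)
  assume "\<not> ?thesis"
  then have big: "(k + 1) * Im (F v) < e"
    by (simp add: k_def e_def)
  then have e: "0 < e"
    using k Fv by (smt (verit) mult_nonneg_nonneg)
  have "Im (F w) - Im (F v) \<le> e"
    unfolding e_def using abs_Im_le_cmod[of "F w - F v"] by simp
  have "e\<^sup>2 \<le> k * (Im (F w) * Im (F v))"
    using Schwarz_Pick_half_plane[OF hol nonneg w v] w v
    by (simp add: k_def e_def field_simps)
  also have "\<dots> \<le> k * ((e + Im (F v)) * Im (F v))"
    using \<open>Im (F w) - Im (F v) \<le> e\<close> k Fv by (intro mult_left_mono mult_right_mono) auto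
  also have "\<dots> \<le> k * Im (F v) * e + Im (F v) * (k * Im (F v))"
    by (simp add: algebra_simps)
  also have "\<dots> \<le> k * Im (F v) * e + Im (F v) * e"
    using big Fv k by (intro add_left_mono mult_left_mono) (auto simp: algebra_simps)
  also have "\<dots> = (k + 1) * Im (F v) * e"
    by (simp add: algebra_simps)
  also have "\<dots> < e * e"
    using big e by simp
  finally show False by (simp add: power2_eq_square)
qed

lemma Harnack_half_plane_compact:
  assumes K: "compact K" "K \<subseteq> upper_half_plane" and v: "v \<in> upper_half_plane"
  obtains B where "0 \<le> B"
    "\<And>F w. \<lbrakk>F holomorphic_on upper_half_plane; \<And>u. u \<in> upper_half_plane \<Longrightarrow> 0 \<le> Im (F u); w \<in> K\<rbrakk>
      \<Longrightarrow> cmod (F w - F v) \<le> B * Im (F v)"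
proof -
  define k where "k w = (cmod (w - v))\<^sup>2 / (Im w * Im v) + 1" for w
  have "continuous_on K k"
    unfolding k_def using K(2) v
    by (intro continuous_intros) (auto simp: upper_half_plane_def)
  then have "bounded (k ` K)"
    using K(1) by (intro compact_imp_bounded compact_continuous_image)
  then obtain B where B: "\<And>w. w \<in> K \<Longrightarrow> \<bar>k w\<bar> \<le> B"
    unfolding bounded_iff by auto
  show thesis
  proof
    show "0 \<le> \<bar>B\<bar>" by simp
    fix F :: "complex \<Rightarrow> complex" and w
    assume hol: "F holomorphic_on upper_half_plane"
      and nonneg: "\<And>u. u \<in> upper_half_plane \<Longrightarrow> 0 \<le> Im (F u)" and w: "w \<in> K"
    have "0 < Im w" "0 < Im v"
      using w K(2) v by (auto simp: upper_half_plane_def)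
    then have "cmod (F w - F v) \<le> k w * Im (F v)"
      unfolding k_def by (intro Harnack_half_plane hol nonneg)
    also have "\<dots> \<le> \<bar>B\<bar> * Im (F v)"
      using B[OF w] nonneg[OF v] by (intro mult_right_mono) auto
    finally show "cmod (F w - F v) \<le> \<bar>B\<bar> * Im (F v)" .
  qed
qed

section \<open>Half-plane maps that do not decrease the imaginary part\<close>

text \<open>
  In the Schwarz-Pick inequality for \<open>w\<close> and \<open>\<i> y\<close>, divided by \<open>y\<^sup>3\<close>, the quotients
  \<open>f (\<i> y) / y\<close> tend to \<open>\<i>\<close> as \<open>y\<close> goes to infinity, and only \<open>Im w \<le> Im (f w)\<close> remains.
\<close>
lemma Julia_half_plane:
  assumes hol: "f holomorphic_on upper_half_plane"
    and maps: "f \<in> upper_half_plane \<rightarrow> upper_half_plane"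
    and radial: "((\<lambda>y. f (\<i> * of_real y) / (\<i> * of_real y)) \<longlongrightarrow> 1) at_top"
    and w: "w \<in> upper_half_plane"
  shows "Im w \<le> Im (f w)"
proof -
  have f_over: "((\<lambda>y. f (\<i> * of_real y) / of_real y) \<longlongrightarrow> \<i>) at_top"
    using tendsto_mult[OF tendsto_const[of \<i>] radial] by simp
  have over_0: "((\<lambda>y. c / complex_of_real y) \<longlongrightarrow> 0) at_top" for c
    using tendsto_mult[OF tendsto_const[of c]
        tendsto_of_real[OF tendsto_inverse_0_at_top[OF filterlim_ident], where 'a = complex]]
    by (simp add: divide_inverse)
  let ?L = "\<lambda>y. (cmod (f w / of_real y - f (\<i> * of_real y) / of_real y))\<^sup>2 * Im w"
  let ?R = "\<lambda>y. (cmod (w / of_real y - \<i>))\<^sup>2 * (Im (f w) * Im (f (\<i> * of_real y) / of_real y))"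
  have L: "(?L \<longlongrightarrow> (cmod (0 - \<i>))\<^sup>2 * Im w) at_top"
    by (intro tendsto_intros over_0 f_over)
  have R: "(?R \<longlongrightarrow> (cmod (0 - \<i>))\<^sup>2 * (Im (f w) * Im \<i>)) at_top"
    by (intro tendsto_intros over_0 f_over)
  have "?L y \<le> ?R y" if y: "0 < y" for y :: real
  proof -
    have a: "f w / of_real y - f (\<i> * of_real y) / of_real y = (f w - f (\<i> * of_real y)) / of_real y"
      and b: "w / of_real y - \<i> = (w - \<i> * of_real y) / of_real y"
      using y by (simp_all add: field_simps)
    have "0 \<le> Im (f u)" if "u \<in> upper_half_plane" for u
      using funcset_mem[OF maps that] by (simp add: upper_half_plane_def)
    then have "(cmod (f w - f (\<i> * of_real y)))\<^sup>2 * (Im w * Im (\<i> * of_real y))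
      \<le> (cmod (w - \<i> * of_real y))\<^sup>2 * (Im (f w) * Im (f (\<i> * of_real y)))"
      using w y by (intro Schwarz_Pick_half_plane[OF hol]) (auto simp: upper_half_plane_def)
    then have "(cmod (f w - f (\<i> * of_real y)))\<^sup>2 * (Im w * y) / y ^ 3
      \<le> (cmod (w - \<i> * of_real y))\<^sup>2 * (Im (f w) * Im (f (\<i> * of_real y))) / y ^ 3"
      using y by (intro divide_right_mono) auto
    then show ?thesis
      unfolding a b norm_divide power_divide Im_divide_of_real norm_of_real using y
      by (simp add: power2_eq_square power3_eq_cube mult.assoc)
  qed
  then have "\<forall>\<^sub>F y in at_top. ?L y \<le> ?R y"
    by (rule eventually_mono[OF eventually_gt_at_top])
  then have "(cmod (0 - \<i>))\<^sup>2 * Im w \<le> (cmod (0 - \<i>))\<^sup>2 * (Im (f w) * Im \<i>)"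
    by (rule tendsto_le[OF trivial_limit_at_top_linorder R L])
  then show ?thesis by simp
qed

text \<open>
  A map that raises every point must separate some point from all points that are at least as high.
  A point \<open>w\<close> where \<open>Im (q w) / Im w\<close> is less than twice its infimum \<open>c\<close> works:
  there \<open>q\<close> is a dilation by \<open>c\<close> plus a perturbation \<open>r\<close> which Schwarz-Pick makes
  Lipschitz with a constant below \<open>c\<close>.
\<close>
lemma injective_point_of_half_plane_map:
  assumes hol: "q holomorphic_on upper_half_plane"
    and ge: "\<And>w. w \<in> upper_half_plane \<Longrightarrow> Im w \<le> Im (q w)"
  obtains w where "w \<in> upper_half_plane"
    "\<And>w'. Im w \<le> Im w' \<Longrightarrow> q w' = q w \<Longrightarrow> w' = w"
proof -
  define c where "c = (INF w\<in>upper_half_plane. Im (q w) / Im w)"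
  have ratio: "1 \<le> Im (q w) / Im w" if "w \<in> upper_half_plane" for w
    using ge[OF that] that by (simp add: upper_half_plane_def)
  have ne: "upper_half_plane \<noteq> {}"
    by (auto simp: upper_half_plane_def intro: exI[of _ \<i>])
  have bdd: "bdd_below ((\<lambda>w. Im (q w) / Im w) ` upper_half_plane)"
    using ratio by (auto intro!: bdd_belowI2)
  have c: "1 \<le> c"
    unfolding c_def using ratio by (intro cINF_greatest[OF ne])
  have c_le: "c * Im w \<le> Im (q w)" if "w \<in> upper_half_plane" for w
    using cINF_lower[OF bdd that] that by (simp add: c_def upper_half_plane_def field_simps)
  have "c < 2 * c" using c by simp
  then obtain w where w: "w \<in> upper_half_plane" and "Im (q w) / Im w < 2 * c"
    using cINF_less_iff[OF ne bdd] c_def by auto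
  then have qw: "Im (q w) < 2 * c * Im w"
    by (simp add: upper_half_plane_def field_simps)
  have "w' = w" if le: "Im w \<le> Im w'" and eq: "q w' = q w" for w'
  proof (rule ccontr)
    assume neq: "w' \<noteq> w"
    define r where "r = (\<lambda>u. q u - of_real c * u)"
    have holr: "r holomorphic_on upper_half_plane"
      unfolding r_def by (intro holomorphic_intros hol)
    have r_nonneg: "0 \<le> Im (r u)" if "u \<in> upper_half_plane" for u
      using c_le[OF that] by (simp add: r_def)
    have w0: "0 < Im w" "0 < Im w'"
      using w le by (auto simp: upper_half_plane_def)
    \<comment> \<open>At \<open>w\<close> this is the choice of \<open>w\<close>; it carries over to \<open>w'\<close> because \<open>q\<close> takes the same value
      there while \<open>c * Im w'\<close> is at least \<open>c * Im w\<close>.\<close>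
    have r_less: "Im (r w) < c * Im w" "Im (r w') < c * Im w'"
    proof -
      show "Im (r w) < c * Im w" using qw by (simp add: r_def)
      moreover have "c * Im w \<le> c * Im w'" using le c by simp
      ultimately show "Im (r w') < c * Im w'" using eq by (simp add: r_def)
    qed
    have "r w' - r w = of_real c * (w - w')"
      by (simp add: r_def eq algebra_simps)
    then have "cmod (r w' - r w) = c * cmod (w' - w)"
      using c by (simp add: norm_mult norm_minus_commute)
    then have "(c * cmod (w' - w))\<^sup>2 * (Im w' * Im w) \<le> (cmod (w' - w))\<^sup>2 * (Im (r w') * Im (r w))"
      using Schwarz_Pick_half_plane[OF holr r_nonneg w0(2,1)] by simp
    moreover have "Im (r w') * Im (r w) < (c * Im w') * (c * Im w)"
      using r_less r_nonneg w0 by (intro mult_strict_mono') (auto simp: upper_half_plane_def)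
    then have "(cmod (w' - w))\<^sup>2 * (Im (r w') * Im (r w)) < (cmod (w' - w))\<^sup>2 * ((c * Im w') * (c * Im w))"
      using neq by (intro mult_strict_left_mono) auto
    ultimately show False
      by (simp add: power2_eq_square algebra_simps)
  qed
  with w that show thesis by blast
qed

section \<open>Orbits of bounded height\<close>

lemma holomorphic_on_funpow:
  assumes "f holomorphic_on A" "f \<in> A \<rightarrow> A"
  shows "(f ^^ n) holomorphic_on A" and "f ^^ n \<in> A \<rightarrow> A"
proof (induction n)
  case (Suc n)
  { case 1
    show ?case
      unfolding funpow.simps(2)
      by (rule holomorphic_on_compose_gen[OF Suc(1) assms(1)]) (use Suc in auto) }
  { case 2
    show ?case using Suc(2) assms(2) by auto }
qed auto

lemma Im_funpow_mono:
  assumes maps: "f \<in> upper_half_plane \<rightarrow> upper_half_plane"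
    and ge: "\<And>w. w \<in> upper_half_plane \<Longrightarrow> Im w \<le> Im (f w)"
    and w: "w \<in> upper_half_plane" and "n \<le> m"
  shows "Im ((f ^^ n) w) \<le> Im ((f ^^ m) w)"
proof (rule lift_Suc_mono_le[OF _ \<open>n \<le> m\<close>])
  fix k
  have "(f ^^ k) w \<in> upper_half_plane"
    using maps w by (induction k) auto
  from ge[OF this] show "Im ((f ^^ k) w) \<le> Im ((f ^^ Suc k) w)" by simp
qed

text \<open>
  The differences \<open>u m - u n\<close> with \<open>n \<le> m\<close> have nonnegative imaginary part, and at \<open>v\<close> they equal
  \<open>\<i>\<close> times an increment of the convergent sequence of heights.  Harnack's inequality spreads
  this smallness over \<open>K\<close>.
\<close>
lemma translated_iterates_uniform_limit:
  assumes hol: "f holomorphic_on upper_half_plane"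
    and maps: "f \<in> upper_half_plane \<rightarrow> upper_half_plane"
    and ge: "\<And>w. w \<in> upper_half_plane \<Longrightarrow> Im w \<le> Im (f w)"
    and v: "v \<in> upper_half_plane" and M: "\<And>n. Im ((f ^^ n) v) \<le> M"
    and K: "compact K" "K \<subseteq> upper_half_plane"
  defines "u \<equiv> \<lambda>n w. (f ^^ n) w - of_real (Re ((f ^^ n) v))"
  shows "uniform_limit K u (\<lambda>w. lim (\<lambda>n. u n w)) sequentially"
proof -
  obtain B where "0 \<le> B" and B: "\<And>F w. \<lbrakk>F holomorphic_on upper_half_plane;
      \<And>u. u \<in> upper_half_plane \<Longrightarrow> 0 \<le> Im (F u); w \<in> K\<rbrakk> \<Longrightarrow> cmod (F w - F v) \<le> B * Im (F v)"
    using Harnack_half_plane_compact[OF K v] by blast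
  define y where "y n = Im ((f ^^ n) v)" for n
  have mono: "Im ((f ^^ n) w) \<le> Im ((f ^^ m) w)" if "w \<in> upper_half_plane" "n \<le> m" for w n m
    by (rule Im_funpow_mono[OF maps ge that])
  have "incseq y"
    unfolding y_def incseq_def using mono[OF v] by blast
  then obtain y' where "y \<longlonglongrightarrow> y'"
    using incseq_convergent[of y M] M unfolding y_def by metis
  then have "Cauchy y"
    by (rule LIMSEQ_imp_Cauchy)
  have diff: "cmod (u m w - u n w) \<le> (B + 1) * (y m - y n)" if "n \<le> m" "w \<in> K" for m n w
  proof -
    define d where "d = (\<lambda>w. u m w - u n w)"
    have "d holomorphic_on upper_half_plane"
      unfolding d_def u_def by (intro holomorphic_intros holomorphic_on_funpow hol maps)
    moreover have "0 \<le> Im (d z)" if "z \<in> upper_half_plane" for z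
      unfolding d_def u_def using mono[OF that \<open>n \<le> m\<close>] by simp
    ultimately have "cmod (d w - d v) \<le> B * Im (d v)"
      using B[of d w] \<open>w \<in> K\<close> by blast
    moreover have "Im (d v) = y m - y n" "Re (d v) = 0"
      by (simp_all add: d_def u_def y_def)
    moreover have "0 \<le> y m - y n"
      using \<open>incseq y\<close> that(1) by (simp add: incseq_def)
    ultimately have "cmod (d w - d v) \<le> B * (y m - y n)" "cmod (d v) = y m - y n"
      by (simp_all add: cmod_def)
    then show ?thesis
      using norm_triangle_sub[of "d w" "d v"] by (simp add: d_def algebra_simps)
  qed
  have "uniformly_Cauchy_on K u"
  proof (rule uniformly_Cauchy_onI')
    fix e :: real assume e: "0 < e"
    have "0 < e / (B + 1)" using e \<open>0 \<le> B\<close> by simp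
    then obtain N where N: "\<And>m n. m \<ge> N \<Longrightarrow> n \<ge> N \<Longrightarrow> \<bar>y m - y n\<bar> < e / (B + 1)"
      using CauchyD[OF \<open>Cauchy y\<close>] by (metis real_norm_def)
    have "dist (u n w) (u m w) < e" if "w \<in> K" "n \<ge> N" "m > n" for w m n
    proof -
      have "cmod (u m w - u n w) \<le> (B + 1) * (y m - y n)"
        using diff that by simp
      also have "\<dots> < e"
        using N[of m n] incseqD[OF \<open>incseq y\<close>, of n m] that \<open>0 \<le> B\<close> by (simp add: field_simps)
      finally show ?thesis by (simp add: dist_norm norm_minus_commute)
    qed
    then show "\<exists>N. \<forall>w\<in>K. \<forall>n\<ge>N. \<forall>m>n. dist (u n w) (u m w) < e" by blast
  qed
  then show ?thesis
    using Cauchy_uniformly_convergent uniformly_convergent_uniform_limit_iff by blast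
qed

text \<open>
  This is where bounded height and the absence of fixed points give steps that do not die out: the limit
  \<open>q\<close> of the translated iterates satisfies \<open>q (f z) = q z + b\<close>, with \<open>b\<close> the limit of the increments,
  and \<open>b = 0\<close> is impossible at a point \<open>w\<close> that \<open>q\<close> separates from \<open>f w\<close>.
\<close>
lemma orbit_increments_converge:
  assumes hol: "f holomorphic_on upper_half_plane"
    and maps: "f \<in> upper_half_plane \<rightarrow> upper_half_plane"
    and ge: "\<And>w. w \<in> upper_half_plane \<Longrightarrow> Im w \<le> Im (f w)"
    and no_fix: "\<And>w. w \<in> upper_half_plane \<Longrightarrow> f w \<noteq> w"
    and v: "v \<in> upper_half_plane" and M: "\<And>n. Im ((f ^^ n) v) \<le> M"
  obtains b where "b \<noteq> 0" "(\<lambda>n. (f ^^ Suc n) v - (f ^^ n) v) \<longlonglongrightarrow> b"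
proof -
  define u where "u n w = (f ^^ n) w - of_real (Re ((f ^^ n) v))" for n w
  define q where "q w = lim (\<lambda>n. u n w)" for w
  have unif: "uniform_limit K u q sequentially" if "compact K" "K \<subseteq> upper_half_plane" for K
    using translated_iterates_uniform_limit[OF hol maps ge v M that]
    by (simp add: u_def[abs_def] q_def[abs_def])
  have lim: "(\<lambda>n. u n w) \<longlonglongrightarrow> q w" if "w \<in> upper_half_plane" for w
    using tendsto_uniform_limitI[OF unif[of "{w}"]] that by simp
  have holq: "q holomorphic_on upper_half_plane"
  proof (rule holomorphic_uniform_sequence[OF open_upper_half_plane])
    show "u n holomorphic_on upper_half_plane" for n
      unfolding u_def[abs_def] by (intro holomorphic_intros holomorphic_on_funpow hol maps)
    show "\<exists>d>0. cball x d \<subseteq> upper_half_plane \<and> uniform_limit (cball x d) u q sequentially"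
      if x: "x \<in> upper_half_plane" for x
      using open_contains_cball[of upper_half_plane] open_upper_half_plane unif x
      by (metis compact_cball)
  qed
  have Im_u_ge: "Im w \<le> Im (u n w)" if "w \<in> upper_half_plane" for w n
    using Im_funpow_mono[OF maps ge that le0, of n] by (simp add: u_def)
  have q_ge: "Im w \<le> Im (q w)" if "w \<in> upper_half_plane" for w
    by (rule tendsto_lowerbound[OF tendsto_Im[OF lim[OF that]]]) (use Im_u_ge[OF that] in auto)
  obtain w where w: "w \<in> upper_half_plane"
    and inj: "\<And>w'. Im w \<le> Im w' \<Longrightarrow> q w' = q w \<Longrightarrow> w' = w"
    using injective_point_of_half_plane_map[OF holq q_ge] by blast
  define a where "a n = complex_of_real (Re ((f ^^ Suc n) v) - Re ((f ^^ n) v))" for n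
  \<comment> \<open>Since \<open>a\<close> does not involve \<open>z\<close>, its limit can be computed at whichever point is convenient.\<close>
  have a: "a n = u n (f z) - u (Suc n) z" for n z
    by (simp add: a_def u_def funpow_swap1)
  have a_lim: "a \<longlonglongrightarrow> q (f z) - q z" if "z \<in> upper_half_plane" for z
    unfolding a[of _ z] using lim[OF that] lim[of "f z"] maps that
    by (intro tendsto_diff) (auto intro: LIMSEQ_Suc)
  have "q (f w) - q w \<noteq> 0"
    using inj[OF ge[OF w]] no_fix[OF w] by auto
  moreover have "(\<lambda>n. a n + (u (Suc n) v - u n v)) \<longlonglongrightarrow> (q (f w) - q w) + (q v - q v)"
    by (intro tendsto_intros a_lim w lim v LIMSEQ_Suc)
  then have "(\<lambda>n. (f ^^ Suc n) v - (f ^^ n) v) \<longlonglongrightarrow> q (f w) - q w"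
    by (simp add: a_def u_def algebra_simps)
  ultimately show thesis using that by blast
qed

text \<open>Cesaro's theorem: \<open>a n / n\<close> is, up to \<open>a 0 / n\<close>, the average of the first \<open>n\<close> increments.\<close>
lemma tendsto_ratio_of_increments:
  fixes a :: "nat \<Rightarrow> 'a :: real_normed_field"
  assumes "(\<lambda>n. a (Suc n) - a n) \<longlonglongrightarrow> b"
  shows "(\<lambda>n. a n / of_nat n) \<longlonglongrightarrow> b"
proof (rule LIMSEQ_I)
  fix e :: real assume e: "0 < e"
  define d where "d n = a n - of_nat n * b" for n
  obtain N where N: "\<And>n. n \<ge> N \<Longrightarrow> norm (a (Suc n) - a n - b) < e / 2"
    using LIMSEQ_D[OF assms, of "e / 2"] e by auto
  have d_le: "norm (d n) \<le> norm (d N) + real (n - N) * (e / 2)" if "n \<ge> N" for n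
    using that
  proof (induction n rule: dec_induct)
    case (step n)
    have "d (Suc n) = d n + (a (Suc n) - a n - b)"
      by (simp add: d_def algebra_simps)
    then have "norm (d (Suc n)) \<le> norm (d n) + e / 2"
      using norm_triangle_ineq[of "d n" "a (Suc n) - a n - b"] N[of n] step by auto
    also have "\<dots> \<le> norm (d N) + real (n - N) * (e / 2) + e / 2"
      using step by simp
    also have "\<dots> = norm (d N) + real (Suc n - N) * (e / 2)"
      using step by (simp add: Suc_diff_le field_simps)
    finally show ?case .
  qed simp
  obtain M where M: "2 * norm (d N) / e < real M"
    using reals_Archimedean2 by blast
  show "\<exists>no. \<forall>n\<ge>no. norm (a n / of_nat n - b) < e"
  proof (intro exI allI impI)
    fix n assume n: "n \<ge> max (Suc N) M"
    then have n0: "0 < real n" by simp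
    have "norm (d N) < real n * (e / 2)"
      using M n e by (simp add: field_simps) (smt (verit) mult_left_mono of_nat_mono)
    moreover have "real (n - N) * (e / 2) \<le> real n * (e / 2)"
      using e by (intro mult_right_mono) auto
    ultimately have "norm (d n) < e * real n"
      using d_le[of n] n by (simp add: algebra_simps) argo
    moreover have "a n / of_nat n - b = d n / of_nat n"
      using n0 by (simp add: d_def field_simps)
    ultimately show "norm (a n / of_nat n - b) < e"
      using n0 by (simp add: norm_divide field_simps)
  qed
qed

text \<open>
  By Harnack's inequality the distance from \<open>(f ^^ n) w\<close> to \<open>(f ^^ n) v\<close> is bounded in terms of the
  height of the latter, so it disappears after division by \<open>n\<close>.
\<close>
lemma iterates_over_n_uniform_limit:
  assumes hol: "f holomorphic_on upper_half_plane"
    and maps: "f \<in> upper_half_plane \<rightarrow> upper_half_plane"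
    and ge: "\<And>w. w \<in> upper_half_plane \<Longrightarrow> Im w \<le> Im (f w)"
    and no_fix: "\<And>w. w \<in> upper_half_plane \<Longrightarrow> f w \<noteq> w"
    and v: "v \<in> upper_half_plane" and M: "\<And>n. Im ((f ^^ n) v) \<le> M"
  obtains b where "b \<noteq> 0" "\<And>K. compact K \<Longrightarrow> K \<subseteq> upper_half_plane \<Longrightarrow>
    uniform_limit K (\<lambda>n w. (f ^^ n) w / of_nat n) (\<lambda>_. b) sequentially"
proof -
  obtain b where b: "b \<noteq> 0" "(\<lambda>n. (f ^^ Suc n) v - (f ^^ n) v) \<longlonglongrightarrow> b"
    using orbit_increments_converge[OF hol maps ge no_fix v M] by blast
  define t where "t n w = ((f ^^ n) w - (f ^^ n) v) / of_nat n" for n w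
  have "uniform_limit K (\<lambda>n w. (f ^^ n) w / of_nat n) (\<lambda>_. b) sequentially"
    if K: "compact K" "K \<subseteq> upper_half_plane" for K
  proof -
    obtain B where "0 \<le> B" and B: "\<And>F w. \<lbrakk>F holomorphic_on upper_half_plane;
        \<And>u. u \<in> upper_half_plane \<Longrightarrow> 0 \<le> Im (F u); w \<in> K\<rbrakk> \<Longrightarrow> cmod (F w - F v) \<le> B * Im (F v)"
      using Harnack_half_plane_compact[OF K v] by blast
    have t_le: "cmod (t n w) \<le> B * M / real n" if "w \<in> K" for n w
    proof -
      have "0 \<le> Im ((f ^^ n) u)" if "u \<in> upper_half_plane" for u
        using funcset_mem[OF holomorphic_on_funpow(2)[OF hol maps] that, of n]
        by (simp add: upper_half_plane_def)
      then have "cmod ((f ^^ n) w - (f ^^ n) v) \<le> B * Im ((f ^^ n) v)"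
        using B holomorphic_on_funpow(1)[OF hol maps] \<open>w \<in> K\<close> by blast
      also have "\<dots> \<le> B * M"
        using M \<open>0 \<le> B\<close> by (rule mult_left_mono)
      finally show ?thesis
        by (simp add: t_def norm_divide divide_right_mono)
    qed
    have "(\<lambda>n. B * M / real n) \<longlonglongrightarrow> 0"
      by (rule lim_const_over_n)
    then have "uniform_limit K t (\<lambda>_. 0) sequentially"
      unfolding uniform_limit_iff
    proof (intro allI impI)
      fix e :: real assume "0 < e"
      from order_tendstoD(2)[OF \<open>(\<lambda>n. B * M / real n) \<longlonglongrightarrow> 0\<close> this]
      show "\<forall>\<^sub>F n in sequentially. \<forall>w\<in>K. dist (t n w) 0 < e"
      proof eventually_elim
        case (elim n)
        show ?case
        proof
          fix w assume "w \<in> K"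
          from order_le_less_trans[OF t_le[OF this] elim] show "dist (t n w) 0 < e" by simp
        qed
      qed
    qed
    moreover have "uniform_limit K (\<lambda>n _. (f ^^ n) v / of_nat n) (\<lambda>_. b) sequentially"
      using tendsto_ratio_of_increments[OF b(2)]
      by (auto simp: uniform_limit_iff tendsto_iff elim: eventually_mono)
    ultimately have "uniform_limit K (\<lambda>n w. t n w + (f ^^ n) v / of_nat n) (\<lambda>_. 0 + b) sequentially"
      by (rule uniform_limit_add)
    then show ?thesis
      by (simp add: t_def diff_divide_distrib)
  qed
  with b(1) that show thesis by blast
qed

section \<open>Transfer to the disk\<close>

text \<open>
  The distance from \<open>z\<close> to the boundary point \<open>\<tau>\<close> is thus \<open>2 / \<bar>cayley \<tau> z + \<i>\<bar>\<close>, which turns the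
  growth of half-plane orbits into the rate of convergence in the disk.
\<close>
lemma cayley_plus_i:
  assumes "z \<noteq> \<tau>"
  shows "cayley \<tau> z + \<i> = 2 * \<i> * \<tau> / (\<tau> - z)"
  using assms by (simp add: cayley_def field_simps)

text \<open>
  Horocycles at \<open>\<tau>\<close> correspond to the half-planes above horizontal lines, so an orbit that avoids a
  horocycle has bounded height.
\<close>
lemma Im_cayley:
  assumes "cmod \<tau> = 1"
  shows "Im (cayley \<tau> z) = (1 - (cmod z)\<^sup>2) / (cmod (\<tau> - z))\<^sup>2"
proof -
  have "Re ((\<tau> + z) * cnj (\<tau> - z)) = (cmod \<tau>)\<^sup>2 - (cmod z)\<^sup>2"
    by (simp add: cmod_power2) (simp add: power2_eq_square algebra_simps)
  then have "Re ((\<tau> + z) / (\<tau> - z)) = (1 - (cmod z)\<^sup>2) / (cmod (\<tau> - z))\<^sup>2"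
    unfolding complex_div_cnj[of "\<tau> + z"] using assms
    by (metis Re_divide_of_real of_real_power one_power2)
  then show ?thesis
    by (simp add: cayley_def del: times_divide_eq_right)
qed

lemma cayley_in_upper_half_plane:
  assumes "cmod \<tau> = 1" "z \<in> unit_disk"
  shows "cayley \<tau> z \<in> upper_half_plane"
proof -
  have "(cmod z)\<^sup>2 < 1" using assms by (simp add: power_less_one_iff abs_square_less_1)
  moreover have "\<tau> \<noteq> z" using assms by auto
  ultimately show ?thesis
    unfolding upper_half_plane_def mem_Collect_eq Im_cayley[OF assms(1)] by simp
qed

definition cayley_inv :: "complex \<Rightarrow> complex \<Rightarrow> complex" where
  "cayley_inv \<tau> w = \<tau> * (w - \<i>) / (w + \<i>)"

lemma upper_half_plane_plus_i: "w \<in> upper_half_plane \<Longrightarrow> w + \<i> \<noteq> 0"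
  by (auto simp: upper_half_plane_def complex_eq_iff)

lemma cayley_inv_in_unit_disk:
  assumes "cmod \<tau> = 1" "w \<in> upper_half_plane"
  shows "cayley_inv \<tau> w \<in> unit_disk"
  using cmod_diff_less_diff_cnj_iff[of \<i> w] upper_half_plane_plus_i[OF assms(2)] assms
  by (simp add: cayley_inv_def norm_mult norm_divide upper_half_plane_def)

lemma cayley_cayley_inv:
  assumes "\<tau> \<noteq> 0" "w \<in> upper_half_plane"
  shows "cayley \<tau> (cayley_inv \<tau> w) = w"
proof -
  note ne = upper_half_plane_plus_i[OF assms(2)]
  have "\<tau> + cayley_inv \<tau> w = 2 * \<tau> * w / (w + \<i>)" "\<tau> - cayley_inv \<tau> w = 2 * \<tau> * \<i> / (w + \<i>)"
    using ne by (simp_all add: cayley_inv_def field_simps)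
  then show ?thesis
    using ne assms(1) by (simp add: cayley_def)
qed

lemma inj_on_cayley:
  assumes "cmod \<tau> = 1"
  shows "inj_on (cayley \<tau>) unit_disk"
proof (rule inj_onI)
  fix x y assume xy: "x \<in> unit_disk" "y \<in> unit_disk" "cayley \<tau> x = cayley \<tau> y"
  have ne: "x \<noteq> \<tau>" "y \<noteq> \<tau>" "\<tau> \<noteq> 0" using xy assms by auto
  then have "2 * \<i> * \<tau> / (\<tau> - x) = 2 * \<i> * \<tau> / (\<tau> - y)"
    using xy(3) cayley_plus_i by metis
  then show "x = y" using ne by simp
qed

lemma inv_into_cayley:
  assumes "cmod \<tau> = 1" "w \<in> upper_half_plane"
  shows "inv_into unit_disk (cayley \<tau>) w = cayley_inv \<tau> w"
  using assms by (intro inv_into_f_eq inj_on_cayley cayley_inv_in_unit_disk cayley_cayley_inv) auto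

lemma holomorphic_on_cayley:
  assumes "cmod \<tau> = 1"
  shows "cayley \<tau> holomorphic_on unit_disk"
  unfolding cayley_def[abs_def] using assms by (intro holomorphic_intros) auto

lemma half_plane_conjugate_eq:
  assumes "cmod \<tau> = 1" "w \<in> upper_half_plane"
  shows "half_plane_conjugate \<tau> g w = cayley \<tau> (g (cayley_inv \<tau> w))"
  using inv_into_cayley[OF assms] by (simp add: half_plane_conjugate_def)

lemma half_plane_conjugate_self_map:
  assumes \<tau>: "cmod \<tau> = 1" and g: "holomorphic_self_map_disk g"
  shows "half_plane_conjugate \<tau> g holomorphic_on upper_half_plane"
    and "half_plane_conjugate \<tau> g \<in> upper_half_plane \<rightarrow> upper_half_plane"
proof -
  have holg: "g holomorphic_on unit_disk" and mapsg: "g ` unit_disk \<subseteq> unit_disk"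
    using g by (auto simp: holomorphic_self_map_disk_def)
  have "cayley_inv \<tau> holomorphic_on upper_half_plane"
    unfolding cayley_inv_def[abs_def]
    by (intro holomorphic_intros) (use upper_half_plane_plus_i in auto)
  then have "(g \<circ> cayley_inv \<tau>) holomorphic_on upper_half_plane"
    by (rule holomorphic_on_compose_gen[OF _ holg]) (use cayley_inv_in_unit_disk[OF \<tau>] in auto)
  then have "(cayley \<tau> \<circ> (g \<circ> cayley_inv \<tau>)) holomorphic_on upper_half_plane"
    by (rule holomorphic_on_compose_gen[OF _ holomorphic_on_cayley[OF \<tau>]])
      (use cayley_inv_in_unit_disk[OF \<tau>] mapsg in fastforce)
  then show "half_plane_conjugate \<tau> g holomorphic_on upper_half_plane"
    by (rule holomorphic_transform) (simp add: half_plane_conjugate_eq[OF \<tau>])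
  show "half_plane_conjugate \<tau> g \<in> upper_half_plane \<rightarrow> upper_half_plane"
  proof
    fix w assume w: "w \<in> upper_half_plane"
    have "g (cayley_inv \<tau> w) \<in> unit_disk"
      using mapsg cayley_inv_in_unit_disk[OF \<tau> w] by blast
    then show "half_plane_conjugate \<tau> g w \<in> upper_half_plane"
      unfolding half_plane_conjugate_eq[OF \<tau> w] by (rule cayley_in_upper_half_plane[OF \<tau>])
  qed
qed

lemma funpow_in_unit_disk:
  assumes "holomorphic_self_map_disk g" "z \<in> unit_disk"
  shows "(g ^^ n) z \<in> unit_disk"
proof (induction n)
  case (Suc n)
  then have "g ((g ^^ n) z) \<in> unit_disk"
    using assms(1) unfolding holomorphic_self_map_disk_def by blast
  then show ?case by simp
qed (use assms(2) in simp)

lemma half_plane_conjugate_funpow: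
  assumes \<tau>: "cmod \<tau> = 1" and g: "holomorphic_self_map_disk g" and z: "z \<in> unit_disk"
  shows "(half_plane_conjugate \<tau> g ^^ n) (cayley \<tau> z) = cayley \<tau> ((g ^^ n) z)"
proof (induction n)
  case (Suc n)
  have "inv_into unit_disk (cayley \<tau>) (cayley \<tau> ((g ^^ n) z)) = (g ^^ n) z"
    by (rule inv_into_f_f[OF inj_on_cayley[OF \<tau>] funpow_in_unit_disk[OF g z]])
  then show ?case
    using Suc by (simp add: half_plane_conjugate_def)
qed simp

text \<open>The imaginary axis lies in every sector, and Julia's inequality only requires the limit there.\<close>
lemma radial_limit_of_angular_limit:
  assumes "angular_limit_at_infinity h l"
  shows "((\<lambda>y. h (\<i> * of_real y)) \<longlongrightarrow> l) at_top"
proof -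
  let ?F = "inf at_infinity (principal {w\<in>upper_half_plane. \<bar>Re w\<bar> \<le> 1 * Im w})"
  have "(h \<longlongrightarrow> l) ?F"
    using assms zero_less_one unfolding angular_limit_at_infinity_def by blast
  moreover have "filterlim (\<lambda>y. \<i> * complex_of_real y) ?F at_top"
    unfolding filterlim_inf filterlim_principal
  proof
    have "filterlim (\<lambda>y::real. \<bar>y\<bar>) at_top at_top"
      by (rule filterlim_abs_real)
    then show "filterlim (\<lambda>y. \<i> * complex_of_real y) at_infinity at_top"
      by (intro filterlim_norm_at_top_imp_at_infinity) (simp add: norm_mult)
    show "\<forall>\<^sub>F y in at_top. \<i> * complex_of_real y \<in> {w \<in> upper_half_plane. \<bar>Re w\<bar> \<le> 1 * Im w}"
      using eventually_gt_at_top[of "0::real"]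
      by eventually_elim (simp add: upper_half_plane_def)
  qed
  ultimately show ?thesis
    by (rule filterlim_compose)
qed

theorem theorem1p7:
  fixes g :: "complex \<Rightarrow> complex" and \<tau> :: complex
  assumes "holomorphic_self_map_disk g"
    and "denjoy_wolff_point g \<tau>"
    and "parabolic g \<tau>"
    and "finite_shift g \<tau>"
  shows "\<exists>C::real. C > 0 \<and>
    (\<forall>K. compact K \<and> K \<subseteq> unit_disk \<longrightarrow>
       uniform_limit K (\<lambda>n z. real n * cmod ((g ^^ n) z - \<tau>)) (\<lambda>_. C) sequentially)"
proof -
  define f where "f = half_plane_conjugate \<tau> g"
  have \<tau>: "cmod \<tau> = 1"
    using assms(2) by (simp add: denjoy_wolff_point_def)
  have hol: "f holomorphic_on upper_half_plane"
    and maps: "f \<in> upper_half_plane \<rightarrow> upper_half_plane"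
    unfolding f_def by (rule half_plane_conjugate_self_map[OF \<tau> assms(1)])+
  note gn = funpow_in_unit_disk[OF assms(1)]
  have fn: "(f ^^ n) (cayley \<tau> z) = cayley \<tau> ((g ^^ n) z)" if "z \<in> unit_disk" for n z
    unfolding f_def by (rule half_plane_conjugate_funpow[OF \<tau> assms(1) that])
  have no_fix: "f w \<noteq> w" if w: "w \<in> upper_half_plane" for w
  proof
    assume "f w = w"
    define z where "z = cayley_inv \<tau> w"
    have z: "z \<in> unit_disk" and Sz: "cayley \<tau> z = w"
      unfolding z_def using \<tau> w
      by (blast intro: cayley_inv_in_unit_disk, intro cayley_cayley_inv) auto
    have "cayley \<tau> (g z) = cayley \<tau> z"
      using fn[OF z, of 1] \<open>f w = w\<close> by (simp add: Sz)
    then have "g z = z"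
      using inj_onD[OF inj_on_cayley[OF \<tau>] _ gn[OF z, of 1] z] by simp
    then show False
      using assms(3) z by (auto simp: parabolic_def non_elliptic_def)
  qed
  have "((\<lambda>y. f (\<i> * of_real y) / (\<i> * of_real y)) \<longlongrightarrow> 1) at_top"
    using assms(3) unfolding parabolic_def f_def by (blast dest: radial_limit_of_angular_limit)
  then have ge: "Im w \<le> Im (f w)" if "w \<in> upper_half_plane" for w
    using Julia_half_plane[OF hol maps] that by blast
  obtain z0 R where z0: "z0 \<in> unit_disk" and R: "0 < R" "\<And>n. (g ^^ n) z0 \<notin> horocycle \<tau> R"
    using assms(4) unfolding finite_shift_def by blast
  have M: "Im ((f ^^ n) (cayley \<tau> z0)) \<le> 1 / R" for n
  proof -
    define z where "z = (g ^^ n) z0"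
    have z: "cmod z < 1" using gn[OF z0] by (simp add: z_def)
    then have "0 < 1 - (cmod z)\<^sup>2" by (simp add: abs_square_less_1)
    moreover have "0 < (cmod (\<tau> - z))\<^sup>2" using z \<tau> by auto
    moreover have "R \<le> (cmod (\<tau> - z))\<^sup>2 / (1 - (cmod z)\<^sup>2)"
      using R(2)[of n] z by (simp add: z_def horocycle_def)
    ultimately show ?thesis
      unfolding fn[OF z0] Im_cayley[OF \<tau>] z_def[symmetric] using R(1) by (simp add: field_simps)
  qed
  obtain b where b: "b \<noteq> 0" and unif: "\<And>K. compact K \<Longrightarrow> K \<subseteq> upper_half_plane \<Longrightarrow>
      uniform_limit K (\<lambda>n w. (f ^^ n) w / of_nat n) (\<lambda>_. b) sequentially"
    using iterates_over_n_uniform_limit[OF hol maps ge no_fix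
        cayley_in_upper_half_plane[OF \<tau> z0] M] by blast
  have "uniform_limit K (\<lambda>n z. real n * cmod ((g ^^ n) z - \<tau>)) (\<lambda>_. 2 / cmod b) sequentially"
    if K: "compact K" "K \<subseteq> unit_disk" for K
  proof -
    have "compact (cayley \<tau> ` K)"
      using K holomorphic_on_subset[OF holomorphic_on_cayley[OF \<tau>]]
      by (intro compact_continuous_image holomorphic_on_imp_continuous_on) auto
    moreover have "cayley \<tau> ` K \<subseteq> upper_half_plane"
      using cayley_in_upper_half_plane[OF \<tau>] K(2) by blast
    ultimately have "uniform_limit K (\<lambda>n z. (f ^^ n) (cayley \<tau> z) / of_nat n) (\<lambda>_. b) sequentially"
      by (intro uniform_limit_compose'[OF unif]) auto
    moreover have "uniform_limit K (\<lambda>n _. \<i> / of_nat n) (\<lambda>_. 0) sequentially"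
      using lim_const_over_n[of \<i>]
      by (auto simp: uniform_limit_iff tendsto_iff elim: eventually_mono)
    ultimately have "uniform_limit K (\<lambda>n z. (f ^^ n) (cayley \<tau> z) / of_nat n + \<i> / of_nat n)
        (\<lambda>_. b + 0) sequentially"
      by (rule uniform_limit_add)
    then have "uniform_limit K (\<lambda>n z. inverse ((f ^^ n) (cayley \<tau> z) / of_nat n + \<i> / of_nat n))
        (inverse \<circ> (\<lambda>_. b + 0)) sequentially"
      by (rule uniform_lim_inverse[where b = "cmod b"]) (use b in auto)
    then have "uniform_limit K
        (\<lambda>n z. 2 * cmod (inverse ((f ^^ n) (cayley \<tau> z) / of_nat n + \<i> / of_nat n)))
        (\<lambda>z. 2 * cmod ((inverse \<circ> (\<lambda>_. b + 0)) z)) sequentially"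
      by (intro uniform_limit_intros)
    moreover have "2 * cmod (inverse ((f ^^ n) (cayley \<tau> z) / of_nat n + \<i> / of_nat n))
        = real n * cmod ((g ^^ n) z - \<tau>)" if z: "z \<in> K" and n: "0 < n" for n z
    proof -
      have "(g ^^ n) z \<noteq> \<tau>" using gn[of z n] z K(2) \<tau> by auto
      then have "(f ^^ n) (cayley \<tau> z) + \<i> = 2 * \<i> * \<tau> / (\<tau> - (g ^^ n) z)"
        using fn[of z n] z K(2) cayley_plus_i by auto
      then have "cmod ((f ^^ n) (cayley \<tau> z) + \<i>) = 2 / cmod ((g ^^ n) z - \<tau>)"
        by (simp add: norm_divide norm_mult \<tau> norm_minus_commute)
      then have "cmod ((f ^^ n) (cayley \<tau> z) / of_nat n + \<i> / of_nat n)
          = 2 / cmod ((g ^^ n) z - \<tau>) / real n"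
        by (simp add: add_divide_distrib[symmetric] norm_divide)
      then show ?thesis
        by (simp add: norm_inverse)
    qed
    then have "\<forall>\<^sub>F n in sequentially. \<forall>z\<in>K.
        2 * cmod (inverse ((f ^^ n) (cayley \<tau> z) / of_nat n + \<i> / of_nat n))
        = real n * cmod ((g ^^ n) z - \<tau>)"
      by (intro eventually_mono[OF eventually_gt_at_top[of "0::nat"]] ballI)
    ultimately show ?thesis
      by (subst (asm) uniform_limit_cong) (auto simp: norm_inverse divide_inverse)
  qed
  then show ?thesis
    using b by (intro exI[of _ "2 / cmod b"]) auto
qed

end
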